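(* Let $\{X_i : i\in I\}$ be a finite collection of real Banach spaces, let $Y_i$ be a closed linear subspace of $X_i$ for every $i\in I$, and let $1\leq p < \infty$. Let $X=(\oplus_pX_i)_{i \in I}$ and $Y=(\oplus_pY_i)_{i \in I}$. Then $(Y_i, \mathcal{F}_i)$ has property-$(P_2)$ for every $i\in I$, where $\mathcal{F}_i=\{F_i \in CB(X_i): rad_{Y_i}(F_i)= 1\}$, if and only if $(Y, \mathcal{F})$ has property-$(P_2)$, where $\mathcal{F}=\{F \in \mathcal{P}(X): rad_Y(F) = 1\}$.
   Context: For a real Banach space $X$, $CL(X)$ and $CB(X)$ denote the sets of non-empty closed, respectively non-empty closed bounded, subsets of $X$; $B_X$ is the closed unit ball. For $x\in X$ and $F\in CB(X)$, $r(x,F)=\sup\{\|x-a\|: a\in F\}$. For $V\in CL(X)$, $rad_V(F)=\inf\{r(v,F): v\in V\}$, $Z_V(F)=\{v\in V: r(v,F)=rad_V(F)\}$, and for $\delta\ge 0$, $Z_V(F,\delta)=\{v\in V: r(v,F)\le rad_V(F)+\delta\}$. For $\mathcal{F}\subseteq CB(X)$, the pair $(V,\mathcal{F})$ has property-$(P_2)$ if $Z_V(G)\ne\emptyset$ for every $G\in\mathcal{F}$ and for every $\epsilon>0$ there exists $\delta>0$ such that $Z_V(G,\delta)\subseteq Z_V(G)+\epsilon B_X$ for every $G\in\mathcal{F}$. $(\oplus_p X_i)_{i\in I}$ is the $\ell_p$-direct sum: the product $\prod_{i\in I}X_i$ with norm $\|x\|=(\sum_{i\in I}\|x_i\|^p)^{1/p}$;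 $Y=(\oplus_p Y_i)_{i\in I}$ is regarded as a closed subspace of $X$. $\mathcal{P}(X)$ denotes the collection of all $F\in CB(X)$ of the form $F=\prod_{i\in I}F_i$ with $F_i\in CB(X_i)$ for every $i\in I$. *)

theory Defs
  imports "HOL-Analysis.Analysis"
begin

(* A real Banach space is given by a carrier X, which is a linear subspace of a real vector space
   without any topology of its own, together with a norm N on X.  Members of a finite family of
   Banach spaces may thus carry unrelated norms.  Sharing the ambient vector space 'a is no
   restriction: any finite family of Banach spaces embeds linearly into the algebraic product of
   its members. *)

(* The value off the carrier is a dummy: the library locale Metric_space requires a distance
   that is nonnegative and symmetric on the whole type. *)
definition norm_dist :: "'a::real_vector set \<Rightarrow> ('a \<Rightarrow> real) \<Rightarrow> 'a \<Rightarrow> 'a \<Rightarrow> real" where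
  "norm_dist X N x y = (if x \<in> X \<and> y \<in> X then N (x - y) else 0)"

definition normed_space :: "'a::real_vector set \<Rightarrow> ('a \<Rightarrow> real) \<Rightarrow> bool" where
  "normed_space X N \<longleftrightarrow> subspace X
     \<and> (\<forall>x\<in>X. 0 \<le> N x)
     \<and> (\<forall>x\<in>X. N x = 0 \<longleftrightarrow> x = 0)
     \<and> (\<forall>c. \<forall>x\<in>X. N (c *\<^sub>R x) = \<bar>c\<bar> * N x)
     \<and> (\<forall>x\<in>X. \<forall>y\<in>X. N (x + y) \<le> N x + N y)"

definition banach_space :: "'a::real_vector set \<Rightarrow> ('a \<Rightarrow> real) \<Rightarrow> bool" where
  "banach_space X N \<longleftrightarrow> normed_space X N \<and> Metric_space.mcomplete X (norm_dist X N)"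

lemma normed_space_imp_Metric_space:
  assumes "normed_space X N"
  shows "Metric_space X (norm_dist X N)"
proof
  have sub: "subspace X" and nn: "\<And>x. x \<in> X \<Longrightarrow> 0 \<le> N x"
    and z: "\<And>x. x \<in> X \<Longrightarrow> N x = 0 \<longleftrightarrow> x = 0"
    and sc: "\<And>c x. x \<in> X \<Longrightarrow> N (c *\<^sub>R x) = \<bar>c\<bar> * N x"
    and tri: "\<And>x y. x \<in> X \<Longrightarrow> y \<in> X \<Longrightarrow> N (x + y) \<le> N x + N y"
    using assms unfolding normed_space_def by auto
  have diff: "x - y \<in> X" if "x \<in> X" "y \<in> X" for x y
    using sub that by (rule subspace_diff)
  fix x y w
  show "0 \<le> norm_dist X N x y"
    by (simp add: norm_dist_def nn diff)
  show "norm_dist X N x y = norm_dist X N y x"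
    using sc[of "x - y" "-1"] by (auto simp: norm_dist_def diff)
  show "norm_dist X N x y = 0 \<longleftrightarrow> x = y" if "x \<in> X" "y \<in> X"
    using that by (simp add: norm_dist_def z diff)
  show "norm_dist X N x w \<le> norm_dist X N x y + norm_dist X N y w"
    if "x \<in> X" "y \<in> X" "w \<in> X"
    using that tri[of "x - y" "y - w"] by (simp add: norm_dist_def diff)
qed

definition CL :: "'a::real_vector set \<Rightarrow> ('a \<Rightarrow> real) \<Rightarrow> 'a set set" where
  "CL X N = {F. F \<noteq> {} \<and> closedin (Metric_space.mtopology X (norm_dist X N)) F}"

definition CB :: "'a::real_vector set \<Rightarrow> ('a \<Rightarrow> real) \<Rightarrow> 'a set set" where
  "CB X N = {F \<in> CL X N. Metric_space.mbounded X (norm_dist X N) F}"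

definition farthest :: "('a::real_vector \<Rightarrow> real) \<Rightarrow> 'a \<Rightarrow> 'a set \<Rightarrow> real" where
  "farthest N x F = (SUP a\<in>F. N (x - a))"

definition rad :: "('a::real_vector \<Rightarrow> real) \<Rightarrow> 'a set \<Rightarrow> 'a set \<Rightarrow> real" where
  "rad N V F = (INF v\<in>V. farthest N v F)"

definition centers :: "('a::real_vector \<Rightarrow> real) \<Rightarrow> 'a set \<Rightarrow> 'a set \<Rightarrow> 'a set" where
  "centers N V F = {v \<in> V. farthest N v F = rad N V F}"

definition near_centers ::
  "('a::real_vector \<Rightarrow> real) \<Rightarrow> 'a set \<Rightarrow> 'a set \<Rightarrow> real \<Rightarrow> 'a set" where
  "near_centers N V F \<delta> = {v \<in> V. farthest N v F \<le> rad N V F + \<delta>}"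

definition unit_ball :: "'a set \<Rightarrow> ('a \<Rightarrow> real) \<Rightarrow> 'a set" where
  "unit_ball X N = {x \<in> X. N x \<le> 1}"

definition property_P2 ::
  "'a::real_vector set \<Rightarrow> ('a \<Rightarrow> real) \<Rightarrow> 'a set \<Rightarrow> 'a set set \<Rightarrow> bool" where
  "property_P2 X N V \<F> \<longleftrightarrow>
     (\<forall>G\<in>\<F>. centers N V G \<noteq> {}) \<and>
     (\<forall>\<epsilon>>0. \<exists>\<delta>>0. \<forall>G\<in>\<F>.
        near_centers N V G \<delta> \<subseteq> {z + \<epsilon> *\<^sub>R b | z b. z \<in> centers N V G \<and> b \<in> unit_ball X N})"

(* The type 'a ^ 'i serves only as the real vector space of 'i-indexed families; its
   library (Euclidean) norm plays no role. *)
definition family_prod :: "('i::finite \<Rightarrow> 'a set) \<Rightarrow> ('a ^ 'i) set" where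
  "family_prod F = {x. \<forall>i. x $ i \<in> F i}"

definition lp_norm :: "real \<Rightarrow> ('i::finite \<Rightarrow> 'a \<Rightarrow> real) \<Rightarrow> 'a ^ 'i \<Rightarrow> real" where
  "lp_norm p N x = (\<Sum>i\<in>UNIV. N i (x $ i) powr p) powr (1 / p)"

definition CB_prod ::
  "real \<Rightarrow> ('i::finite \<Rightarrow> 'a::real_vector set) \<Rightarrow> ('i \<Rightarrow> 'a \<Rightarrow> real) \<Rightarrow> ('a ^ 'i) set set" where
  "CB_prod p X N = {F \<in> CB (family_prod X) (lp_norm p N).
     \<exists>G. (\<forall>i. G i \<in> CB (X i) (N i)) \<and> F = family_prod G}"

end

(* Radii of boxes split: r(x, F) and rad_Y(F) are the l_p-combinations of the coordinate radii, hence
   Z_Y(F) is the product of the Z_{Y_i}(F_i).  If sum rad_{Y_i}(F_i)^p = 1, then near-optimality of y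
   forces near-optimality of each coordinate with a uniform additive error, but the hypothesis on
   (Y_i, F_i) only covers radius 1.  Rescaling handles coordinates of radius bounded away from 0;
   for small radius all near-centers are close to any center by the triangle inequality, and for
   radius 0 the set is a singleton contained in the closed subspace.  Conversely, a set in the i-th
   factor is padded with {0} in the other coordinates. *)
theory Submission
  imports Defs
begin

text \<open>The obstacle is uniformity: a box of radius 1 may have coordinate radii anywhere in
  [0, 1], yet one delta must serve all boxes, so no estimate may degenerate as a coordinate radius
  tends to 0. The transfer of the error to coordinate i is uniform because t^p is superadditive for
  p >= 1: if r_j <= s_j for all j, sum r_j^p = 1 and sum s_j^p <= 1 + tau^p, then s_i^p <= r_i^p +
  tau^p <= (r_i + tau)^p. Rescaling a coordinate of radius rho inflates an error tau to tau / rho,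
  hence a threshold. A near-center with error tau lies within 2 rho + tau of any center; with tau <=
  eps / 2 this is at most eps as long as rho <= eps / 4. Above eps / 4 the inflation is at most 4 /
  eps. Suprema and infima need not be attained, so the formulas for boxes come from choosing almost
  optimal points independently in every coordinate, with an error e that tends to 0; that centers
  split needs the strict monotonicity of the l_p-norm in addition.\<close>

section \<open>Convexity of powers and l_p-sums of nonnegative families\<close>

lemma powr_convex_nonneg:
  fixes p s t x y :: real
  assumes "1 \<le> p" "0 \<le> s" "0 \<le> t" "s + t = 1" "0 \<le> x" "0 \<le> y"
  shows "(s * x + t * y) powr p \<le> s * x powr p + t * y powr p"
proof -
  \<comment> \<open>This settles the degenerate cases x = 0 and y = 0; convexity is invoked only for
    two positive arguments.\<close>
  have scale: "(c * z) powr p \<le> c * z powr p" if "0 \<le> c" "c \<le> 1" "0 \<le> z" for c z :: real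
  proof -
    have "c powr p \<le> c"
      using powr_mono'[of 1 p c] assms(1) that by (cases "c = 0") auto
    then show ?thesis
      using that by (simp add: powr_mult mult_right_mono)
  qed
  show ?thesis
  proof (cases "x = 0 \<or> y = 0")
    case True
    then show ?thesis
      using assms scale[of s x] scale[of t y] by auto
  next
    case False
    have "((1 - t) *\<^sub>R x + t *\<^sub>R y) powr p \<le> (1 - t) * x powr p + t * y powr p"
      by (rule convex_onD[OF powr_convex[OF assms(1)]]) (use False assms in auto)
    moreover have "s = 1 - t"
      using assms by simp
    ultimately show ?thesis
      by simp
  qed
qed

text \<open>The fractions a / (a + b) and b / (a + b) lie in [0, 1], where the p-th power is at most
  the number itself, and they add up to 1.\<close>

lemma powr_add_ge:
  fixes a b p :: real
  assumes "1 \<le> p" "0 \<le> a" "0 \<le> b"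
  shows "a powr p + b powr p \<le> (a + b) powr p"
proof (cases "a + b = 0")
  case True
  then have "a = 0" "b = 0"
    using assms by auto
  then show ?thesis
    by simp
next
  case False
  have *: "x powr p \<le> x / (a + b) * (a + b) powr p" if "0 \<le> x" "x \<le> a + b" for x
  proof -
    have "(x / (a + b)) powr p \<le> x / (a + b)"
      using powr_mono'[of 1 p "x / (a + b)"] assms that False by (cases "x = 0") auto
    then show ?thesis
      using that False assms by (simp add: powr_divide field_simps)
  qed
  have "a powr p + b powr p \<le> a / (a + b) * (a + b) powr p + b / (a + b) * (a + b) powr p"
    using *[of a] *[of b] assms by linarith
  also have "\<dots> = (a + b) powr p"
    using False by (simp flip: distrib_right add_divide_distrib)
  finally show ?thesis .
qed

text \<open>This is the l_p-norm on families of numbers, so that norms, farthest distances and radii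
  of coordinates are all combined by one function. No absolute values are taken: it is meant for
  nonnegative families.\<close>

definition lp_sum :: "real \<Rightarrow> ('i::finite \<Rightarrow> real) \<Rightarrow> real" where
  "lp_sum p r = (\<Sum>i\<in>UNIV. r i powr p) powr (1 / p)"

lemma lp_norm_eq_lp_sum: "lp_norm p N x = lp_sum p (\<lambda>i. N i (x $ i))"
  by (simp add: lp_norm_def lp_sum_def)

lemma lp_sum_nonneg [simp]: "0 \<le> lp_sum p r"
  by (simp add: lp_sum_def)

lemma powr_lp_sum:
  assumes "1 \<le> p"
  shows "lp_sum p r powr p = (\<Sum>i\<in>UNIV. r i powr p)"
  using assms by (simp add: lp_sum_def powr_powr sum_nonneg)

lemma le_lp_sum_iff:
  assumes "1 \<le> p" "0 \<le> c"
  shows "c \<le> lp_sum p r \<longleftrightarrow> c powr p \<le> (\<Sum>i\<in>UNIV. r i powr p)"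
  unfolding powr_lp_sum[OF assms(1), symmetric]
  using assms powr_mono2[of p c "lp_sum p r"]
    powr_less_mono2[of p "lp_sum p r" c] by (auto simp: not_le[symmetric])

lemma lp_sum_le_iff:
  assumes "1 \<le> p" "0 \<le> c"
  shows "lp_sum p r \<le> c \<longleftrightarrow> (\<Sum>i\<in>UNIV. r i powr p) \<le> c powr p"
  unfolding powr_lp_sum[OF assms(1), symmetric]
  using assms powr_mono2[of p "lp_sum p r" c]
    powr_less_mono2[of p c "lp_sum p r"] by (auto simp: not_le[symmetric])

lemma lp_sum_mono:
  assumes "1 \<le> p" "\<And>i. 0 \<le> r i" "\<And>i. r i \<le> s i"
  shows "lp_sum p r \<le> lp_sum p s"
  using assms by (auto simp: lp_sum_def intro!: powr_mono2 sum_mono sum_nonneg)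

lemma component_le_lp_sum:
  assumes "1 \<le> p" "0 \<le> r i"
  shows "r i \<le> lp_sum p r"
  using assms by (auto simp: le_lp_sum_iff intro!: member_le_sum)

lemma lp_sum_scale:
  assumes "1 \<le> p" "0 \<le> c" "\<And>i. 0 \<le> r i"
  shows "lp_sum p (\<lambda>i. c * r i) = c * lp_sum p r"
  using assms by (simp add: lp_sum_def powr_mult sum_nonneg powr_powr flip: sum_distrib_left)

lemma lp_sum_eq_0_iff:
  assumes "1 \<le> p" "\<And>i. 0 \<le> r i"
  shows "lp_sum p r = 0 \<longleftrightarrow> (\<forall>i. r i = 0)"
  using assms by (auto simp: lp_sum_def sum_nonneg_eq_0_iff)

lemma lp_sum_single:
  assumes "1 \<le> p" "0 \<le> c"
  shows "lp_sum p (\<lambda>j. if j = i then c else 0) = c"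
proof -
  have "(\<Sum>j\<in>UNIV. (if j = i then c else 0) powr p) = (\<Sum>j\<in>UNIV. if j = i then c powr p else 0)"
    by (rule sum.cong) auto
  then show ?thesis
    using assms by (simp add: lp_sum_def powr_powr)
qed

text \<open>Minkowski's inequality. With A and B the two l_p-sums, r_i + s_i is A + B times the
  convex combination of r_i / A and s_i / B with weights A / (A + B) and B / (A + B). Convexity is
  applied in each coordinate, and the normalized families have power sum 1.\<close>

lemma lp_sum_add:
  assumes p: "1 \<le> p" and r: "\<And>i. 0 \<le> r i" and s: "\<And>i. 0 \<le> s i"
  shows "lp_sum p (\<lambda>i. r i + s i) \<le> lp_sum p r + lp_sum p s"
proof (cases "lp_sum p r = 0 \<or> lp_sum p s = 0")
  case True
  then have "(\<forall>i. r i = 0) \<or> (\<forall>i. s i = 0)"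
    using p r s by (simp add: lp_sum_eq_0_iff)
  then show ?thesis
    by auto
next
  case False
  define A where "A = lp_sum p r"
  define B where "B = lp_sum p s"
  have AB: "0 < A" "0 < B"
    using False by (simp_all add: A_def B_def order_less_le)
  have le: "(r i + s i) powr p
      \<le> (A + B) powr p * (A / (A + B) * (r i powr p / A powr p) + B / (A + B) * (s i powr p / B powr p))" for i
  proof -
    have eq: "r i + s i = (A + B) * (A / (A + B) * (r i / A) + B / (A + B) * (s i / B))"
      unfolding distrib_left using AB by simp
    have "(r i + s i) powr p = (A + B) powr p * (A / (A + B) * (r i / A) + B / (A + B) * (s i / B)) powr p"
      by (subst eq) (use AB r s in \<open>simp add: powr_mult add_nonneg_nonneg\<close>)
    also have "\<dots> \<le> (A + B) powr p * (A / (A + B) * (r i / A) powr p + B / (A + B) * (s i / B) powr p)"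
      by (intro mult_left_mono powr_convex_nonneg)
        (use AB r s p in \<open>auto simp: add_divide_distrib[symmetric]\<close>)
    finally show ?thesis
      using AB r s by (simp add: powr_divide)
  qed
  have "(\<Sum>i\<in>UNIV. (r i + s i) powr p)
      \<le> (\<Sum>i\<in>UNIV. (A + B) powr p * (A / (A + B) * (r i powr p / A powr p) + B / (A + B) * (s i powr p / B powr p)))"
    by (intro sum_mono le)
  also have "\<dots> = (A + B) powr p * (A / (A + B) * ((\<Sum>i\<in>UNIV. r i powr p) / A powr p)
      + B / (A + B) * ((\<Sum>i\<in>UNIV. s i powr p) / B powr p))"
    by (simp only: sum_divide_distrib sum_distrib_left distrib_left sum.distrib)
  also have "\<dots> = (A + B) powr p * (A / (A + B) + B / (A + B))"
    using AB unfolding powr_lp_sum[OF p, symmetric] by (simp flip: A_def B_def)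
  also have "\<dots> = (A + B) powr p"
    using AB by (simp flip: add_divide_distrib)
  finally show ?thesis
    using AB p unfolding A_def[symmetric] B_def[symmetric] by (subst lp_sum_le_iff) auto
qed

text \<open>Superadditivity of the power, iterated over the index set. The l_1 bound is what adds up
  coordinate errors later.\<close>

lemma lp_sum_le_sum:
  assumes "1 \<le> p" "\<And>i. 0 \<le> r i"
  shows "lp_sum p r \<le> (\<Sum>i\<in>UNIV. r i)"
proof -
  have "(\<Sum>i\<in>S. r i powr p) \<le> (\<Sum>i\<in>S. r i) powr p" if "finite S" for S
    using that
  proof induction
    case (insert i S)
    then show ?case
      using powr_add_ge[of p "r i" "sum r S"] assms by (auto simp: sum_nonneg)
  qed simp
  then show ?thesis
    using assms by (simp add: lp_sum_le_iff sum_nonneg)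
qed

text \<open>Minkowski against a constant family. The factor \<open>CARD('i)\<close> is crude but
  harmless, since e is sent to 0.\<close>

lemma lp_sum_add_const:
  fixes r :: "'i::finite \<Rightarrow> real" and e :: real
  assumes "1 \<le> p" "\<And>i. 0 \<le> r i" "0 \<le> e"
  shows "lp_sum p (\<lambda>i. r i + e) \<le> lp_sum p r + CARD('i) * e"
  using lp_sum_add[of p r "\<lambda>_. e"] lp_sum_le_sum[of p "\<lambda>_::'i. e"] assms by simp

text \<open>A strict gap in a single coordinate makes the power sums differ, as no other coordinate
  can compensate. This is what identifies the centers of a box.\<close>

lemma lp_sum_eq_imp_eq:
  assumes "1 \<le> p" "\<And>i. 0 \<le> r i" "\<And>i. r i \<le> s i" "lp_sum p s = lp_sum p r"
  shows "r i = s i"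
proof (rule ccontr)
  assume "r i \<noteq> s i"
  then have "r i powr p < s i powr p"
    using assms(1-3) by (intro powr_less_mono2) (auto simp: order_less_le)
  then have "(\<Sum>i\<in>UNIV. r i powr p) < (\<Sum>i\<in>UNIV. s i powr p)"
    using assms(1-3) by (intro sum_strict_mono_ex1)
      (auto intro!: powr_mono2)
  then show False
    using assms powr_lp_sum[of p r] powr_lp_sum[of p s] by simp
qed

text \<open>The point is the order of quantifiers: \<delta> depends on p and \<tau> only, not on the
  families, which later stand for the coordinate radii and farthest distances of an arbitrary
  box.\<close>

lemma lp_sum_near_imp_component_near:
  assumes "1 \<le> p" "0 < \<tau>"
  obtains \<delta> where "0 < \<delta>"
    "\<And>(r :: 'i::finite \<Rightarrow> real) s i. \<lbrakk>\<And>j. 0 \<le> r j; \<And>j. r j \<le> s j; lp_sum p r = 1; lp_sum p s \<le> 1 + \<delta>\<rbrakk>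
      \<Longrightarrow> s i \<le> r i + \<tau>"
proof
  \<comment> \<open>Chosen so that the p-th power of 1 + \<delta> is exactly 1 + \<tau>^p, that is,
    the power sum of s exceeds that of r by at most \<tau>^p.\<close>
  define \<delta> where "\<delta> = (1 + \<tau> powr p) powr (1 / p) - 1"
  have \<delta>: "(1 + \<delta>) powr p = 1 + \<tau> powr p"
    using assms by (simp add: \<delta>_def powr_powr)
  have "1 powr (1 / p) < (1 + \<tau> powr p) powr (1 / p)"
    using assms by (intro powr_less_mono2) auto
  then show "0 < \<delta>"
    by (simp add: \<delta>_def)
  fix r s :: "'i \<Rightarrow> real" and i
  assume r: "\<And>j. 0 \<le> r j" and rs: "\<And>j. r j \<le> s j"
    and one: "lp_sum p r = 1" and near: "lp_sum p s \<le> 1 + \<delta>"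
  have "(\<Sum>j\<in>UNIV. s j powr p) \<le> (\<Sum>j\<in>UNIV. r j powr p) + \<tau> powr p"
    using near \<open>0 < \<delta>\<close> assms(1) powr_lp_sum[OF assms(1), of r] one
    by (simp add: lp_sum_le_iff \<delta>)
  \<comment> \<open>The other coordinates of s lose nothing against r, so the whole excess may be
    charged to coordinate i.\<close>
  moreover have "(\<Sum>j\<in>UNIV - {i}. r j powr p) \<le> (\<Sum>j\<in>UNIV - {i}. s j powr p)"
    using assms r rs by (intro sum_mono powr_mono2) auto
  ultimately have "s i powr p \<le> r i powr p + \<tau> powr p"
    by (simp add: sum.remove[of UNIV i])
  also have "\<dots> \<le> (r i + \<tau>) powr p"
    using assms r by (intro powr_add_ge) auto
  finally show "s i \<le> r i + \<tau>"
    using powr_less_mono2[of p "r i + \<tau>" "s i"] assms r[of i] by (auto simp: not_le[symmetric])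
qed

section \<open>Normed spaces on a carrier: closed and bounded sets in terms of the norm\<close>

lemma normed_spaceD:
  assumes "normed_space X N"
  shows "subspace X" "\<And>x. x \<in> X \<Longrightarrow> 0 \<le> N x" "\<And>x. x \<in> X \<Longrightarrow> N x = 0 \<longleftrightarrow> x = 0"
    "\<And>c x. x \<in> X \<Longrightarrow> N (c *\<^sub>R x) = \<bar>c\<bar> * N x"
    "\<And>x y. \<lbrakk>x \<in> X; y \<in> X\<rbrakk> \<Longrightarrow> N (x + y) \<le> N x + N y"
    "\<And>x y. \<lbrakk>x \<in> X; y \<in> X\<rbrakk> \<Longrightarrow> x - y \<in> X"
    "\<And>c x. x \<in> X \<Longrightarrow> c *\<^sub>R x \<in> X"
    "0 \<in> X" "N 0 = 0"
  using assms by (auto simp: normed_space_def subspace_diff subspace_scale subspace_0)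

lemma normed_space_minus_commute:
  assumes "normed_space X N" "x \<in> X" "y \<in> X"
  shows "N (x - y) = N (y - x)"
  using normed_spaceD(4)[OF assms(1), of "y - x" "-1"] normed_spaceD(6)[OF assms(1)] assms by simp

lemma normed_space_triangle:
  assumes "normed_space X N" "x \<in> X" "y \<in> X" "z \<in> X"
  shows "N (x - z) \<le> N (x - y) + N (y - z)"
  using normed_spaceD(5)[OF assms(1), of "x - y" "y - z"] normed_spaceD(6)[OF assms(1)] assms by simp

lemma normed_space_triangle_diff:
  assumes "normed_space X N" "x \<in> X" "y \<in> X"
  shows "N (x - y) \<le> N x + N y"
  using normed_space_triangle[OF assms(1), of x 0 y] normed_space_minus_commute[OF assms(1), of 0 y]
    normed_spaceD(8)[OF assms(1)] assms by simp

text \<open>A ball around x misses F exactly when every point of F is at distance at least its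
  radius from x. In this form closedness passes easily to scaled sets and to boxes.\<close>

lemma closedin_normed_iff:
  assumes "normed_space X N"
  shows "closedin (Metric_space.mtopology X (norm_dist X N)) F
    \<longleftrightarrow> F \<subseteq> X \<and> (\<forall>x\<in>X - F. \<exists>r>0. \<forall>y\<in>F. r \<le> N (x - y))"
proof -
  interpret Metric_space X "norm_dist X N"
    using assms by (rule normed_space_imp_Metric_space)
  have "disjnt F (mball x r) \<longleftrightarrow> (\<forall>y\<in>F. r \<le> N (x - y))" if "F \<subseteq> X" "x \<in> X" for x r
    using that by (auto simp: disjnt_iff norm_dist_def not_less subset_iff)
  then show ?thesis
    unfolding closedin_metric by (intro conj_cong) auto
qed

lemma mbounded_normed_iff:
  assumes "normed_space X N" "F \<subseteq> X"
  shows "Metric_space.mbounded X (norm_dist X N) F \<longleftrightarrow> (\<exists>B. \<forall>y\<in>F. N y \<le> B)"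
proof -
  interpret Metric_space X "norm_dist X N"
    using assms(1) by (rule normed_space_imp_Metric_space)
  note ns = normed_spaceD[OF assms(1)]
  show ?thesis
  proof
    assume "mbounded F"
    then obtain c B where c: "F \<subseteq> mcball c B"
      by (auto simp: mbounded_def)
    have "N y \<le> N c + B" if "y \<in> F" for y
    proof -
      have "y \<in> X" "c \<in> X" "N (c - y) \<le> B"
        using c that by (auto simp: norm_dist_def subset_iff)
      then show ?thesis
        using normed_space_triangle_diff[OF assms(1), of c "c - y"] ns(6) by fastforce
    qed
    then show "\<exists>B. \<forall>y\<in>F. N y \<le> B"
      by blast
  next
    assume "\<exists>B. \<forall>y\<in>F. N y \<le> B"
    then obtain B where "\<And>y. y \<in> F \<Longrightarrow> N y \<le> B"
      by blast
    then have "F \<subseteq> mcball 0 B"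
      using assms ns(8) normed_space_minus_commute[OF assms(1), of 0]
      by (auto simp: norm_dist_def subset_iff)
    then show "mbounded F"
      by (auto simp: mbounded_def)
  qed
qed

lemma mem_CB_iff:
  assumes "normed_space X N"
  shows "F \<in> CB X N \<longleftrightarrow> F \<noteq> {} \<and> F \<subseteq> X \<and> (\<forall>x\<in>X - F. \<exists>r>0. \<forall>y\<in>F. r \<le> N (x - y))
    \<and> (\<exists>B. \<forall>y\<in>F. N y \<le> B)"
  unfolding CB_def CL_def using mbounded_normed_iff[OF assms, of F]
  by (auto simp: closedin_normed_iff[OF assms])

lemma CB_D:
  assumes "F \<in> CB X N" "normed_space X N"
  shows "F \<noteq> {}" "F \<subseteq> X"
  using assms by (auto simp: mem_CB_iff)

section \<open>Farthest distances and restricted radii\<close>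

lemma le_farthest:
  assumes ns: "normed_space X N" and F: "F \<in> CB X N" and "x \<in> X" "a \<in> F"
  shows "N (x - a) \<le> farthest N x F"
proof -
  obtain B where B: "\<And>y. y \<in> F \<Longrightarrow> N y \<le> B"
    using F unfolding mem_CB_iff[OF ns] by blast
  have "N (x - y) \<le> N x + B" if "y \<in> F" for y
  proof -
    have "y \<in> X"
      using CB_D(2)[OF F ns] that by blast
    then show ?thesis
      using normed_space_triangle_diff[OF ns \<open>x \<in> X\<close>, of y] B[OF that] by linarith
  qed
  then have "bdd_above ((\<lambda>a. N (x - a)) ` F)"
    by (meson bdd_above.I2)
  then show ?thesis
    unfolding farthest_def using assms by (intro cSUP_upper)
qed

lemma farthest_le:
  assumes "F \<noteq> {}" "\<And>a. a \<in> F \<Longrightarrow> N (x - a) \<le> c"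
  shows "farthest N x F \<le> c"
  unfolding farthest_def using assms by (intro cSUP_least)

lemma farthest_nonneg:
  assumes ns: "normed_space X N" and F: "F \<in> CB X N" and "x \<in> X"
  shows "0 \<le> farthest N x F"
proof -
  obtain a where a: "a \<in> F" "a \<in> X"
    using CB_D[OF F ns] by blast
  have "0 \<le> N (x - a)"
    by (intro normed_spaceD(2,6)[OF ns] \<open>x \<in> X\<close> a)
  then show ?thesis
    using le_farthest[OF assms a(1)] by linarith
qed

lemma farthest_approx:
  assumes "F \<noteq> {}" "0 < e"
  obtains a where "a \<in> F" "farthest N x F \<le> N (x - a) + e"
proof -
  have "\<exists>a\<in>F. farthest N x F - e < N (x - a)"
  proof (rule ccontr)
    assume "\<not> ?thesis"
    then have "farthest N x F \<le> farthest N x F - e"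
      by (intro farthest_le assms(1)) (simp add: not_less)
    then show False
      using assms(2) by simp
  qed
  then obtain a where "a \<in> F" "farthest N x F - e < N (x - a)"
    by blast
  then show ?thesis
    using that[of a] by simp
qed

text \<open>Both points are compared with one point of F. Applied to a near-center and a center, it
  gives twice the radius plus the error, which suffices when the radius is small.\<close>

lemma diff_le_farthest_add:
  assumes ns: "normed_space X N" and F: "F \<in> CB X N" and "x \<in> X" "y \<in> X"
  shows "N (x - y) \<le> farthest N x F + farthest N y F"
proof -
  obtain a where a: "a \<in> F" "a \<in> X"
    using CB_D[OF F ns] by blast
  then show ?thesis
    using normed_space_triangle[OF ns, of x a y] normed_space_minus_commute[OF ns, of a y]
      le_farthest[OF ns F, of x a] le_farthest[OF ns F, of y a] assms by linarith
qed

lemma rad_le_farthest: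
  assumes "normed_space X N" "F \<in> CB X N" "V \<subseteq> X" "v \<in> V"
  shows "rad N V F \<le> farthest N v F"
proof -
  have "bdd_below ((\<lambda>v. farthest N v F) ` V)"
    using farthest_nonneg[OF assms(1,2)] assms(3) by (meson bdd_below.I2 subsetD)
  then show ?thesis
    unfolding rad_def using assms by (intro cINF_lower)
qed

lemma le_rad:
  assumes "V \<noteq> {}" "\<And>v. v \<in> V \<Longrightarrow> c \<le> farthest N v F"
  shows "c \<le> rad N V F"
  unfolding rad_def using assms by (intro cINF_greatest)

lemma rad_nonneg:
  assumes "normed_space X N" "F \<in> CB X N" "V \<subseteq> X" "V \<noteq> {}"
  shows "0 \<le> rad N V F"
  using assms by (auto intro!: le_rad farthest_nonneg)

lemma rad_approx:
  assumes "V \<noteq> {}" "0 < e"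
  obtains v where "v \<in> V" "farthest N v F \<le> rad N V F + e"
proof -
  have "\<exists>v\<in>V. farthest N v F < rad N V F + e"
  proof (rule ccontr)
    assume "\<not> ?thesis"
    then have "rad N V F + e \<le> rad N V F"
      by (intro le_rad assms(1)) (simp add: not_less)
    then show False
      using assms(2) by simp
  qed
  then obtain v where "v \<in> V" "farthest N v F < rad N V F + e"
    by blast
  then show ?thesis
    using that[of v] by simp
qed

text \<open>The vector of the unit ball can only be the difference y - z divided by \<epsilon>, and
  it lies in X because y and z lie in V. The inclusion thus becomes a distance estimate, the form in
  which both implications are proved.\<close>

lemma property_P2_iff:
  assumes ns: "normed_space X N" and V: "V \<subseteq> X"
  shows "property_P2 X N V \<F> \<longleftrightarrow> (\<forall>G\<in>\<F>. centers N V G \<noteq> {}) \<and>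
     (\<forall>\<epsilon>>0. \<exists>\<delta>>0. \<forall>G\<in>\<F>. \<forall>y\<in>near_centers N V G \<delta>. \<exists>z\<in>centers N V G. N (y - z) \<le> \<epsilon>)"
proof -
  have "y \<in> {z + \<epsilon> *\<^sub>R b | z b. z \<in> centers N V G \<and> b \<in> unit_ball X N}
      \<longleftrightarrow> (\<exists>z\<in>centers N V G. N (y - z) \<le> \<epsilon>)" if "0 < \<epsilon>" "y \<in> near_centers N V G \<delta>" for y \<epsilon> \<delta> G
  proof -
    have "(\<exists>b\<in>unit_ball X N. y = z + \<epsilon> *\<^sub>R b) \<longleftrightarrow> N (y - z) \<le> \<epsilon>" if "z \<in> centers N V G" for z
    proof
      assume "\<exists>b\<in>unit_ball X N. y = z + \<epsilon> *\<^sub>R b"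
      then obtain b where "b \<in> X" "N b \<le> 1" "y - z = \<epsilon> *\<^sub>R b"
        by (auto simp: unit_ball_def)
      then show "N (y - z) \<le> \<epsilon>"
        using \<open>0 < \<epsilon>\<close> normed_spaceD(4)[OF ns, of b \<epsilon>] by (simp add: mult_left_le)
    next
      assume le: "N (y - z) \<le> \<epsilon>"
      have "y - z \<in> X"
        using that V \<open>y \<in> near_centers N V G \<delta>\<close> normed_spaceD(6)[OF ns]
        by (auto simp: centers_def near_centers_def)
      then have "(1 / \<epsilon>) *\<^sub>R (y - z) \<in> unit_ball X N"
        using le \<open>0 < \<epsilon>\<close> normed_spaceD(4)[OF ns, of "y - z" "1 / \<epsilon>"] normed_spaceD(7)[OF ns]
        by (simp add: unit_ball_def)
      moreover have "y = z + \<epsilon> *\<^sub>R ((1 / \<epsilon>) *\<^sub>R (y - z))"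
        using \<open>0 < \<epsilon>\<close> by simp
      ultimately show "\<exists>b\<in>unit_ball X N. y = z + \<epsilon> *\<^sub>R b"
        by blast
    qed
    then show ?thesis
      by blast
  qed
  then show ?thesis
    unfolding property_P2_def subset_iff Ball_def by meson
qed

section \<open>Homogeneity under scaling by a positive factor\<close>

lemma farthest_scaleR:
  assumes ns: "normed_space X N" and F: "F \<in> CB X N" and x: "x \<in> X" and c: "0 < c"
  shows "farthest N (c *\<^sub>R x) ((*\<^sub>R) c ` F) = c * farthest N x F"
proof (rule antisym)
  note FX = CB_D[OF F ns]
  have N: "N (c *\<^sub>R x - c *\<^sub>R a) = c * N (x - a)" if "a \<in> F" for a
  proof -
    have "x - a \<in> X"
      using that FX x normed_spaceD(6)[OF ns] by blast
    then show ?thesis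
      using normed_spaceD(4)[OF ns, of "x - a" c] c by (simp add: scaleR_diff_right)
  qed
  show "farthest N (c *\<^sub>R x) ((*\<^sub>R) c ` F) \<le> c * farthest N x F"
    using FX N c le_farthest[OF ns F x] by (auto intro!: farthest_le)
  have "N (x - a) \<le> farthest N (c *\<^sub>R x) ((*\<^sub>R) c ` F) / c" if "a \<in> F" for a
  proof -
    \<comment> \<open>Using the supremum as an upper bound requires bounded distances to the scaled
      set; the bound is inherited from F.\<close>
    have "bdd_above ((\<lambda>a. N (c *\<^sub>R x - a)) ` (*\<^sub>R) c ` F)"
      using N c le_farthest[OF ns F x] by (auto intro!: bdd_aboveI[of _ "c * farthest N x F"])
    then have "N (c *\<^sub>R x - c *\<^sub>R a) \<le> farthest N (c *\<^sub>R x) ((*\<^sub>R) c ` F)"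
      unfolding farthest_def by (intro cSUP_upper) (use that in auto)
    then show ?thesis
      using N[OF that] c by (simp add: field_simps)
  qed
  then have "farthest N x F \<le> farthest N (c *\<^sub>R x) ((*\<^sub>R) c ` F) / c"
    using FX by (intro farthest_le)
  then show "c * farthest N x F \<le> farthest N (c *\<^sub>R x) ((*\<^sub>R) c ` F)"
    using c by (simp add: field_simps)
qed

text \<open>Since V is a subspace, multiplication by c permutes V, so both infima range over
  corresponding points.\<close>

lemma rad_scaleR:
  assumes ns: "normed_space X N" and F: "F \<in> CB X N" and V: "V \<subseteq> X" "subspace V" and c: "0 < c"
  shows "rad N V ((*\<^sub>R) c ` F) = c * rad N V F"
proof (rule antisym)
  have Vne: "V \<noteq> {}"
    using V(2) subspace_0 by blast
  have far: "farthest N v ((*\<^sub>R) c ` F) = c * farthest N ((1 / c) *\<^sub>R v) F" if "v \<in> V" for v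
    using farthest_scaleR[OF ns F _ c, of "(1 / c) *\<^sub>R v"] that V normed_spaceD(7)[OF ns] c by auto
  have V': "r *\<^sub>R v \<in> V" if "v \<in> V" for v r
    using V(2) that by (rule subspace_scale)
  show "c * rad N V F \<le> rad N V ((*\<^sub>R) c ` F)"
    by (rule le_rad[OF Vne]) (use far V' c rad_le_farthest[OF ns F V(1)] in auto)
  have "rad N V ((*\<^sub>R) c ` F) / c \<le> farthest N v F" if "v \<in> V" for v
  proof -
    have "bdd_below ((\<lambda>v. farthest N v ((*\<^sub>R) c ` F)) ` V)"
      using far farthest_nonneg[OF ns F] V(1) V' c
      by (intro bdd_belowI[of _ 0]) (auto intro!: mult_nonneg_nonneg simp: subset_iff)
    then have "rad N V ((*\<^sub>R) c ` F) \<le> farthest N (c *\<^sub>R v) ((*\<^sub>R) c ` F)"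
      unfolding rad_def by (intro cINF_lower) (use V' that in auto)
    then show ?thesis
      using far[OF V'[OF that]] c by (simp add: field_simps)
  qed
  then have "rad N V ((*\<^sub>R) c ` F) / c \<le> rad N V F"
    by (rule le_rad[OF Vne])
  then show "rad N V ((*\<^sub>R) c ` F) \<le> c * rad N V F"
    using c by (simp add: field_simps)
qed

lemma CB_scaleR:
  assumes ns: "normed_space X N" and F: "F \<in> CB X N" and c: "0 < c"
  shows "(*\<^sub>R) c ` F \<in> CB X N"
proof -
  note FX = CB_D[OF F ns]
  obtain B where B: "\<And>y. y \<in> F \<Longrightarrow> N y \<le> B"
    using F unfolding mem_CB_iff[OF ns] by blast
  have "\<exists>r>0. \<forall>y\<in>(*\<^sub>R) c ` F. r \<le> N (x - y)" if x: "x \<in> X - (*\<^sub>R) c ` F" for x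
  proof -
    \<comment> \<open>A gap r around the preimage x' outside F becomes a gap c * r around x.\<close>
    define x' where "x' = (1 / c) *\<^sub>R x"
    have xx': "x = c *\<^sub>R x'"
      using c by (simp add: x'_def)
    have "x' \<in> X - F"
      using x normed_spaceD(7)[OF ns, of x "1 / c"] unfolding x'_def[symmetric] by (auto simp: xx')
    then obtain r where r: "0 < r" "\<And>y. y \<in> F \<Longrightarrow> r \<le> N (x' - y)"
      using F unfolding mem_CB_iff[OF ns] by blast
    have "c * r \<le> N (x - c *\<^sub>R y)" if "y \<in> F" for y
    proof -
      have "x' - y \<in> X"
        using that FX \<open>x' \<in> X - F\<close> normed_spaceD(6)[OF ns] by blast
      then show ?thesis
        using normed_spaceD(4)[OF ns, of "x' - y" c] c r(2)[OF that] by (simp add: xx' scaleR_diff_right)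
    qed
    then show ?thesis
      using c r(1) by (intro exI[of _ "c * r"]) auto
  qed
  moreover have "\<forall>y\<in>(*\<^sub>R) c ` F. N y \<le> c * B"
    using B FX c normed_spaceD(4)[OF ns] by (auto simp: subset_iff)
  ultimately show ?thesis
    using FX normed_spaceD(7)[OF ns] by (auto simp: mem_CB_iff[OF ns])
qed

section \<open>From radius one to all radii at most one\<close>

text \<open>Radius 0 cannot be normalized to 1. Here V has points arbitrarily close to all of F
  simultaneously: closedness puts any a of F into V, and the triangle inequality through such points
  gives F diameter 0, so a is a center.\<close>

lemma centers_nonempty_of_rad_eq_0:
  assumes ns: "normed_space X N" and F: "F \<in> CB X N" and V: "V \<noteq> {}"
    and cl: "closedin (Metric_space.mtopology X (norm_dist X N)) V" and 0: "rad N V F = 0"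
  shows "centers N V F \<noteq> {}"
proof -
  note FX = CB_D[OF F ns]
  have VX: "V \<subseteq> X"
    using cl by (simp add: closedin_normed_iff[OF ns])
  obtain a where a: "a \<in> F" "a \<in> X"
    using FX by blast
  have near: "\<exists>v\<in>V. \<forall>b\<in>F. N (v - b) \<le> e" if e: "0 < e" for e
  proof -
    obtain v where "v \<in> V" "farthest N v F \<le> e"
      using rad_approx[OF V e, where N = N and F = F] 0 by auto
    then show ?thesis
      using le_farthest[OF ns F, of v] VX by (meson order_trans subsetD)
  qed
  have "a \<in> V"
  proof (rule ccontr)
    assume "a \<notin> V"
    then obtain r where r: "0 < r" "\<And>y. y \<in> V \<Longrightarrow> r \<le> N (a - y)"
      using cl a unfolding closedin_normed_iff[OF ns] by blast
    obtain v where v: "v \<in> V" "N (v - a) \<le> r / 2"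
      using near[of "r / 2"] r(1) a by auto
    then show False
      using r(1) r(2)[of v] normed_space_minus_commute[OF ns, of a v] a VX by auto
  qed
  have "farthest N a F \<le> 0"
  proof (rule farthest_le[OF FX(1)], rule field_le_epsilon)
    fix b and e :: real
    assume "b \<in> F" "0 < e"
    then obtain v where "v \<in> V" "N (v - a) \<le> e / 2" "N (v - b) \<le> e / 2"
      using near[of "e / 2"] a by auto
    then show "N (a - b) \<le> 0 + e"
      using normed_space_triangle[OF ns, of a v b] normed_space_minus_commute[OF ns, of a v] a VX FX
        \<open>b \<in> F\<close> by force
  qed
  then have "a \<in> centers N V F"
    using \<open>a \<in> V\<close> farthest_nonneg[OF ns F a(2)] 0 by (simp add: centers_def)
  then show ?thesis
    by blast
qed

text \<open>Centers exist for every radius, but a common \<tau> is claimed only for radii at most 1: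
  scaling back from radius 1 multiplies distances by the radius. Coordinates of a box of radius 1
  satisfy this bound.\<close>

lemma property_P2_rad_le_1:
  assumes ns: "normed_space X N" and V: "subspace V"
    and cl: "closedin (Metric_space.mtopology X (norm_dist X N)) V"
    and P2: "property_P2 X N V {F \<in> CB X N. rad N V F = 1}"
  shows "F \<in> CB X N \<Longrightarrow> centers N V F \<noteq> {}"
    and "0 < \<epsilon> \<Longrightarrow> \<exists>\<tau>>0. \<forall>F\<in>CB X N. rad N V F \<le> 1 \<longrightarrow>
      (\<forall>y\<in>V. farthest N y F \<le> rad N V F + \<tau> \<longrightarrow> (\<exists>z\<in>centers N V F. N (y - z) \<le> \<epsilon>))"
proof -
  have VX: "V \<subseteq> X"
    using cl by (simp add: closedin_normed_iff[OF ns])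
  have Vne: "V \<noteq> {}"
    using V subspace_0 by blast
  have V': "r *\<^sub>R v \<in> V" if "v \<in> V" for v r
    using V that by (rule subspace_scale)
  note P2 = P2[unfolded property_P2_iff[OF ns VX]]
  have scale: "(*\<^sub>R) (1 / rad N V F) ` F \<in> {F \<in> CB X N. rad N V F = 1}"
    if "F \<in> CB X N" "0 < rad N V F" for F
    using that CB_scaleR[OF ns] rad_scaleR[OF ns _ VX V] by simp
  have far: "farthest N v ((*\<^sub>R) (1 / rad N V F) ` F) = farthest N (rad N V F *\<^sub>R v) F / rad N V F"
    if "F \<in> CB X N" "0 < rad N V F" "v \<in> V" for F v
    using farthest_scaleR[OF ns that(1), of "rad N V F *\<^sub>R v" "1 / rad N V F"] that V' VX by auto
  have cen: "rad N V F *\<^sub>R z \<in> centers N V F"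
    if "F \<in> CB X N" "0 < rad N V F" "z \<in> centers N V ((*\<^sub>R) (1 / rad N V F) ` F)" for F z
    using that far[OF that(1,2)] scale[OF that(1,2)] V' by (auto simp: centers_def)
  show ne: "centers N V F \<noteq> {}" if F: "F \<in> CB X N" for F
  proof (cases "rad N V F = 0")
    case True
    then show ?thesis
      using centers_nonempty_of_rad_eq_0[OF ns F Vne cl] by blast
  next
    case False
    then have "0 < rad N V F"
      using rad_nonneg[OF ns F VX Vne] by simp
    then show ?thesis
      using P2 scale[OF F] cen[OF F] by blast
  qed
  assume "0 < \<epsilon>"
  then obtain \<delta> where "0 < \<delta>" and \<delta>: "\<And>G y. \<lbrakk>G \<in> {F \<in> CB X N. rad N V F = 1}; y \<in> near_centers N V G \<delta>\<rbrakk>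
      \<Longrightarrow> \<exists>z\<in>centers N V G. N (y - z) \<le> \<epsilon>"
    using P2 by meson
  \<comment> \<open>The first term serves radii up to \<epsilon> / 4, where 2 (\<epsilon> / 4) +
    \<epsilon> / 2 = \<epsilon>. The second serves radii \<rho> above \<epsilon> / 4, where it is at
    most \<delta> * \<rho> and so becomes an error of at most \<delta> after division by
    \<rho>.\<close>
  define \<tau> where "\<tau> = min (\<epsilon> / 2) (\<delta> * (\<epsilon> / 4))"
  have "\<exists>z\<in>centers N V F. N (y - z) \<le> \<epsilon>"
    if F: "F \<in> CB X N" and le: "rad N V F \<le> 1" and y: "y \<in> V" "farthest N y F \<le> rad N V F + \<tau>" for F y
  proof (cases "rad N V F \<le> \<epsilon> / 4")
    case True
    obtain z where z: "z \<in> centers N V F"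
      using ne[OF F] by blast
    then have "N (y - z) \<le> \<epsilon>"
      using diff_le_farthest_add[OF ns F, of y z] y VX True by (auto simp: centers_def \<tau>_def subset_iff)
    then show ?thesis
      using z by blast
  next
    case False
    define \<rho> where "\<rho> = rad N V F"
    have \<rho>: "0 < \<rho>" "\<rho> \<le> 1" "\<epsilon> / 4 < \<rho>"
      using False \<open>0 < \<epsilon>\<close> le by (auto simp: \<rho>_def)
    let ?G = "(*\<^sub>R) (1 / \<rho>) ` F" and ?y = "(1 / \<rho>) *\<^sub>R y"
    have G: "?G \<in> {F \<in> CB X N. rad N V F = 1}"
      using scale[OF F] \<rho> by (simp add: \<rho>_def)
    have "farthest N y F \<le> \<rho> + \<delta> * (\<epsilon> / 4)"
      using y(2) by (simp add: \<tau>_def \<rho>_def)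
    also have "\<dots> \<le> \<rho> + \<delta> * \<rho>"
      using \<rho> \<open>0 < \<delta>\<close> by (intro add_left_mono mult_left_mono) auto
    finally have "farthest N y F \<le> (1 + \<delta>) * \<rho>"
      by (simp add: algebra_simps)
    then have "farthest N ?y ?G \<le> 1 + \<delta>"
      using far[OF F _ V'[OF y(1)], of "1 / \<rho>"] \<rho> by (simp add: pos_divide_le_eq flip: \<rho>_def)
    then have "?y \<in> near_centers N V ?G \<delta>"
      using G V' y(1) by (simp add: near_centers_def)
    then obtain z where z: "z \<in> centers N V ?G" "N (?y - z) \<le> \<epsilon>"
      using \<delta>[OF G] by blast
    have "?y - z \<in> X"
      using z(1) V'[OF y(1)] VX normed_spaceD(6)[OF ns] by (auto simp: centers_def subset_iff)
    then have "N (y - \<rho> *\<^sub>R z) = \<rho> * N (?y - z)"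
      using normed_spaceD(4)[OF ns, of "?y - z" \<rho>] \<rho> by (simp add: scaleR_diff_right)
    \<comment> \<open>Here \<rho> \<le> 1 enters: scaling back does not enlarge the
      distance.\<close>
    also have "\<dots> \<le> 1 * \<epsilon>"
      using z(2) \<rho> \<open>0 < \<epsilon>\<close> by (intro mult_mono') (use normed_spaceD(2)[OF ns \<open>?y - z \<in> X\<close>] in auto)
    finally show ?thesis
      using cen[OF F] z(1) \<rho> by (auto simp: \<rho>_def)
  qed
  moreover have "0 < \<tau>"
    using \<open>0 < \<epsilon>\<close> \<open>0 < \<delta>\<close> by (simp add: \<tau>_def)
  ultimately show "\<exists>\<tau>>0. \<forall>F\<in>CB X N. rad N V F \<le> 1 \<longrightarrow>
      (\<forall>y\<in>V. farthest N y F \<le> rad N V F + \<tau> \<longrightarrow> (\<exists>z\<in>centers N V F. N (y - z) \<le> \<epsilon>))"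
    by blast
qed

section \<open>Boxes in the l_p-sum\<close>

lemma mem_family_prod [simp]: "x \<in> family_prod F \<longleftrightarrow> (\<forall>i. x $ i \<in> F i)"
  by (simp add: family_prod_def)

lemma family_prod_mono: "(\<And>i. F i \<subseteq> G i) \<Longrightarrow> family_prod F \<subseteq> family_prod G"
  by (auto simp: subset_iff)

lemma family_prod_nonempty:
  assumes "\<And>i. F i \<noteq> {}"
  shows "family_prod F \<noteq> {}"
proof -
  have "(\<chi> i. SOME a. a \<in> F i) \<in> family_prod F"
    using assms by (simp add: some_in_eq)
  then show ?thesis
    by blast
qed

lemma normed_space_family_prod:
  fixes X :: "'i::finite \<Rightarrow> 'a::real_vector set"
  assumes ns: "\<And>i. normed_space (X i) (N i)" and p: "1 \<le> p"
  shows "normed_space (family_prod X) (lp_norm p N)"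
  unfolding normed_space_def
proof (intro conjI ballI allI)
  note D = normed_spaceD[OF ns]
  show "subspace (family_prod X)"
    using D(1) by (auto simp: subspace_def)
  fix x
  assume x: "x \<in> family_prod X"
  then have pos: "0 \<le> N i (x $ i)" for i
    using D(2) by simp
  show "0 \<le> lp_norm p N x"
    by (simp add: lp_norm_eq_lp_sum)
  show "lp_norm p N x = 0 \<longleftrightarrow> x = 0"
    using lp_sum_eq_0_iff[OF p, of "\<lambda>i. N i (x $ i)"] pos x D(3)
    by (simp add: lp_norm_eq_lp_sum vec_eq_iff)
  show "lp_norm p N (c *\<^sub>R x) = \<bar>c\<bar> * lp_norm p N x" for c
    using lp_sum_scale[OF p, of "\<bar>c\<bar>" "\<lambda>i. N i (x $ i)"] pos x D(4)
    by (simp add: lp_norm_eq_lp_sum)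
  fix y
  assume y: "y \<in> family_prod X"
  have "lp_norm p N (x + y) \<le> lp_sum p (\<lambda>i. N i (x $ i) + N i (y $ i))"
    using x y D(2,5) subspace_add[OF D(1)]
    unfolding lp_norm_eq_lp_sum by (intro lp_sum_mono p) auto
  also have "\<dots> \<le> lp_norm p N x + lp_norm p N y"
    using x y D(2) unfolding lp_norm_eq_lp_sum by (intro lp_sum_add p) auto
  finally show "lp_norm p N (x + y) \<le> lp_norm p N x + lp_norm p N y" .
qed

lemma CB_family_prod:
  fixes X :: "'i::finite \<Rightarrow> 'a::real_vector set"
  assumes ns: "\<And>i. normed_space (X i) (N i)" and p: "1 \<le> p" and F: "\<And>i. F i \<in> CB (X i) (N i)"
  shows "family_prod F \<in> CB (family_prod X) (lp_norm p N)"
proof -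
  note D = normed_spaceD[OF ns] and FX = CB_D[OF F ns]
  have "\<forall>i. \<exists>B. \<forall>y\<in>F i. N i y \<le> B"
    using F unfolding mem_CB_iff[OF ns] by blast
  then obtain B where B: "\<And>i y. y \<in> F i \<Longrightarrow> N i y \<le> B i"
    by metis
  have "lp_norm p N y \<le> sum B UNIV" if "y \<in> family_prod F" for y
  proof -
    have "lp_norm p N y \<le> (\<Sum>i\<in>UNIV. N i (y $ i))"
      unfolding lp_norm_eq_lp_sum using that FX(2) D(2) by (intro lp_sum_le_sum p) (auto simp: subset_iff)
    also have "\<dots> \<le> sum B UNIV"
      using that B by (intro sum_mono) auto
    finally show ?thesis .
  qed
  moreover have "\<exists>r>0. \<forall>y\<in>family_prod F. r \<le> lp_norm p N (x - y)"
    if x: "x \<in> family_prod X - family_prod F" for x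
  proof -
    \<comment> \<open>A point outside the box already fails in one coordinate, and the gap there
      bounds the l_p-distance from below.\<close>
    obtain i where i: "x $ i \<in> X i - F i"
      using x by auto
    then obtain r where r: "0 < r" "\<And>y. y \<in> F i \<Longrightarrow> r \<le> N i (x $ i - y)"
      using F[of i] unfolding mem_CB_iff[OF ns] by blast
    have "r \<le> lp_norm p N (x - y)" if "y \<in> family_prod F" for y
    proof -
      have "r \<le> N i ((x - y) $ i)"
        using r(2) that by simp
      also have "\<dots> \<le> lp_norm p N (x - y)"
        using component_le_lp_sum[OF p, of "\<lambda>j. N j ((x - y) $ j)" i] r(1) \<open>r \<le> N i ((x - y) $ i)\<close>
        by (simp add: lp_norm_eq_lp_sum)
      finally show ?thesis .
    qed
    then show ?thesis
      using r(1) by blast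
  qed
  moreover have "family_prod F \<subseteq> family_prod X"
    using FX(2) by (auto simp: subset_iff)
  ultimately show ?thesis
    using family_prod_nonempty[of F] FX(1)
    unfolding mem_CB_iff[OF normed_space_family_prod[OF ns p]] by blast
qed

lemma le_of_le_add_const:
  fixes a b c :: real
  assumes "0 \<le> c" "\<And>e. 0 < e \<Longrightarrow> a \<le> b + c * e"
  shows "a \<le> b"
proof (rule field_le_epsilon)
  fix e :: real
  assume "0 < e"
  \<comment> \<open>Dividing by c + 1 instead of c includes the case c = 0.\<close>
  then have "a \<le> b + c * (e / (c + 1))"
    using assms(1) by (intro assms(2)) simp
  also have "c * (e / (c + 1)) \<le> e"
    using assms \<open>0 < e\<close> by (simp add: field_simps)
  finally show "a \<le> b + e"
    by simp
qed

text \<open>For the lower bound, almost farthest points are picked in each coordinate separately.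
  They form a point of F because F is a box; for general sets only the other inequality
  survives.\<close>

lemma farthest_family_prod:
  fixes X :: "'i::finite \<Rightarrow> 'a::real_vector set"
  assumes ns: "\<And>i. normed_space (X i) (N i)" and p: "1 \<le> p" and F: "\<And>i. F i \<in> CB (X i) (N i)"
    and x: "x \<in> family_prod X"
  shows "farthest (lp_norm p N) x (family_prod F) = lp_sum p (\<lambda>i. farthest (N i) (x $ i) (F i))"
proof (rule antisym)
  note D = normed_spaceD[OF ns] and FX = CB_D[OF F ns]
  have pos: "0 \<le> N i (x $ i - a)" if "a \<in> F i" for i a
    using that x FX(2) D(2,6) by (auto simp: subset_iff)
  show "farthest (lp_norm p N) x (family_prod F) \<le> lp_sum p (\<lambda>i. farthest (N i) (x $ i) (F i))"
    unfolding lp_norm_eq_lp_sum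
    using x pos by (intro farthest_le family_prod_nonempty FX lp_sum_mono p)
      (auto intro: le_farthest[OF ns F])
  show "lp_sum p (\<lambda>i. farthest (N i) (x $ i) (F i)) \<le> farthest (lp_norm p N) x (family_prod F)"
  proof (rule le_of_le_add_const)
    fix e :: real
    assume e: "0 < e"
    have "\<forall>i. \<exists>a\<in>F i. farthest (N i) (x $ i) (F i) \<le> N i (x $ i - a) + e"
      using farthest_approx[OF FX(1) e] by metis
    then obtain a where a: "\<And>i. a i \<in> F i" "\<And>i. farthest (N i) (x $ i) (F i) \<le> N i (x $ i - a i) + e"
      by metis
    have "lp_sum p (\<lambda>i. farthest (N i) (x $ i) (F i)) \<le> lp_sum p (\<lambda>i. N i (x $ i - a i) + e)"
      using a x farthest_nonneg[OF ns F] by (intro lp_sum_mono p) auto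
    also have "\<dots> \<le> lp_sum p (\<lambda>i. N i (x $ i - a i)) + CARD('i) * e"
      using pos a e by (intro lp_sum_add_const p) auto
    also have "lp_sum p (\<lambda>i. N i (x $ i - a i)) = lp_norm p N (x - (\<chi> i. a i))"
      by (simp add: lp_norm_eq_lp_sum)
    also have "\<dots> \<le> farthest (lp_norm p N) x (family_prod F)"
      using a(1) x by (intro le_farthest[OF normed_space_family_prod[OF ns p] CB_family_prod[OF ns p F]]) auto
    finally show "lp_sum p (\<lambda>i. farthest (N i) (x $ i) (F i))
        \<le> farthest (lp_norm p N) x (family_prod F) + CARD('i) * e"
      by simp
  qed simp
qed

text \<open>The product form of V plays the part that the box played for suprema: almost optimal
  points of the V_i assemble into one point of the product.\<close>

lemma rad_family_prod:
  fixes X :: "'i::finite \<Rightarrow> 'a::real_vector set"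
  assumes ns: "\<And>i. normed_space (X i) (N i)" and p: "1 \<le> p" and F: "\<And>i. F i \<in> CB (X i) (N i)"
    and V: "\<And>i. V i \<subseteq> X i" "\<And>i. V i \<noteq> {}"
  shows "rad (lp_norm p N) (family_prod V) (family_prod F) = lp_sum p (\<lambda>i. rad (N i) (V i) (F i))"
proof (rule antisym)
  have far: "farthest (lp_norm p N) v (family_prod F) = lp_sum p (\<lambda>i. farthest (N i) (v $ i) (F i))"
    if "v \<in> family_prod V" for v
    using that family_prod_mono[of V X, OF V(1)] by (intro farthest_family_prod[OF ns p F]) blast
  have VX: "family_prod V \<subseteq> family_prod X"
    by (intro family_prod_mono V)
  show "lp_sum p (\<lambda>i. rad (N i) (V i) (F i)) \<le> rad (lp_norm p N) (family_prod V) (family_prod F)"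
  proof (rule le_rad[OF family_prod_nonempty[OF V(2)]])
    fix v
    assume v: "v \<in> family_prod V"
    show "lp_sum p (\<lambda>i. rad (N i) (V i) (F i)) \<le> farthest (lp_norm p N) v (family_prod F)"
      unfolding far[OF v]
      using v by (intro lp_sum_mono p rad_nonneg[OF ns F V] rad_le_farthest[OF ns F V(1)]) auto
  qed
  show "rad (lp_norm p N) (family_prod V) (family_prod F) \<le> lp_sum p (\<lambda>i. rad (N i) (V i) (F i))"
  proof (rule le_of_le_add_const)
    fix e :: real
    assume e: "0 < e"
    have "\<forall>i. \<exists>v\<in>V i. farthest (N i) v (F i) \<le> rad (N i) (V i) (F i) + e"
      using rad_approx[OF V(2) e] by metis
    then obtain v where v: "\<And>i. v i \<in> V i" "\<And>i. farthest (N i) (v i) (F i) \<le> rad (N i) (V i) (F i) + e"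
      by metis
    have "rad (lp_norm p N) (family_prod V) (family_prod F) \<le> farthest (lp_norm p N) (\<chi> i. v i) (family_prod F)"
      using v(1)
      by (intro rad_le_farthest[OF normed_space_family_prod[OF ns p] CB_family_prod[OF ns p F] VX]) auto
    also have "\<dots> = lp_sum p (\<lambda>i. farthest (N i) (v i) (F i))"
      using v by (simp add: far)
    also have "\<dots> \<le> lp_sum p (\<lambda>i. rad (N i) (V i) (F i) + e)"
      using v V(1) farthest_nonneg[OF ns F] by (intro lp_sum_mono p) (auto simp: subset_iff)
    also have "\<dots> \<le> lp_sum p (\<lambda>i. rad (N i) (V i) (F i)) + CARD('i) * e"
      using e rad_nonneg[OF ns F V] by (intro lp_sum_add_const p) auto
    finally show "rad (lp_norm p N) (family_prod V) (family_prod F)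
        \<le> lp_sum p (\<lambda>i. rad (N i) (V i) (F i)) + CARD('i) * e" .
  qed simp
qed

text \<open>Each coordinate radius is a lower bound for the coordinate farthest distance, so equal
  l_p-sums force equality in every coordinate.\<close>

lemma centers_family_prod:
  fixes X :: "'i::finite \<Rightarrow> 'a::real_vector set"
  assumes ns: "\<And>i. normed_space (X i) (N i)" and p: "1 \<le> p" and F: "\<And>i. F i \<in> CB (X i) (N i)"
    and V: "\<And>i. V i \<subseteq> X i" "\<And>i. V i \<noteq> {}"
  shows "centers (lp_norm p N) (family_prod V) (family_prod F)
    = family_prod (\<lambda>i. centers (N i) (V i) (F i))"
proof -
  have "farthest (lp_norm p N) v (family_prod F) = rad (lp_norm p N) (family_prod V) (family_prod F)
      \<longleftrightarrow> (\<forall>i. farthest (N i) (v $ i) (F i) = rad (N i) (V i) (F i))" if v: "v \<in> family_prod V" for v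
  proof -
    have vX: "v \<in> family_prod X"
      using v by (rule subsetD[OF family_prod_mono, rotated]) (rule V(1))
    show ?thesis
      unfolding farthest_family_prod[OF ns p F vX] rad_family_prod[OF ns p F V]
      using lp_sum_eq_imp_eq[OF p, of "\<lambda>i. rad (N i) (V i) (F i)" "\<lambda>i. farthest (N i) (v $ i) (F i)"]
        rad_nonneg[OF ns F V] rad_le_farthest[OF ns F V(1)] v by auto
  qed
  then show ?thesis
    by (auto simp: centers_def)
qed

section \<open>The two implications\<close>

lemma singleton_0_in_CB:
  assumes ns: "normed_space X N"
  shows "{0} \<in> CB X N"
proof -
  note D = normed_spaceD[OF ns]
  have "\<exists>r>0. \<forall>y\<in>{0}. r \<le> N (x - y)" if "x \<in> X - {0}" for x
    using that D(2,3)[of x] by (intro exI[of _ "N x"]) auto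
  then show ?thesis
    using D(8,9) by (auto simp: mem_CB_iff[OF ns])
qed

lemma rad_singleton_0:
  assumes ns: "normed_space X N" and V: "subspace V" "V \<subseteq> X"
  shows "rad N V {0} = 0"
proof (rule antisym)
  have "0 \<in> V"
    using V subspace_0 by blast
  then show "0 \<le> rad N V {0}"
    using rad_nonneg[OF ns singleton_0_in_CB[OF ns] V(2)] by blast
  show "rad N V {0} \<le> 0"
    using rad_le_farthest[OF ns singleton_0_in_CB[OF ns] V(2) \<open>0 \<in> V\<close>] normed_spaceD(9)[OF ns]
    by (simp add: farthest_def)
qed

lemma property_P2_family_prodI:
  fixes X Y :: "'i::finite \<Rightarrow> 'a::real_vector set"
  assumes ns: "\<And>i. normed_space (X i) (N i)" and Y: "\<And>i. subspace (Y i)"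
    and cl: "\<And>i. closedin (Metric_space.mtopology (X i) (norm_dist (X i) (N i))) (Y i)"
    and p: "1 \<le> p"
    and P2: "\<And>i. property_P2 (X i) (N i) (Y i) {F \<in> CB (X i) (N i). rad (N i) (Y i) F = 1}"
  shows "property_P2 (family_prod X) (lp_norm p N) (family_prod Y)
    {F \<in> CB_prod p X N. rad (lp_norm p N) (family_prod Y) F = 1}"
proof -
  have YX: "Y i \<subseteq> X i" for i
    using cl by (simp add: closedin_normed_iff[OF ns])
  have Yne: "Y i \<noteq> {}" for i
    using Y subspace_0 by blast
  have YX': "family_prod Y \<subseteq> family_prod X"
    by (intro family_prod_mono YX)
  note D = normed_spaceD[OF ns]
    and P2' = property_P2_rad_le_1[OF ns Y cl P2]
  show ?thesis
    unfolding property_P2_iff[OF normed_space_family_prod[OF ns p] YX']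
  proof (intro conjI ballI allI impI)
    fix G
    assume "G \<in> {F \<in> CB_prod p X N. rad (lp_norm p N) (family_prod Y) F = 1}"
    then obtain F where F: "\<And>i. F i \<in> CB (X i) (N i)" and G: "G = family_prod F"
      by (auto simp: CB_prod_def)
    show "centers (lp_norm p N) (family_prod Y) G \<noteq> {}"
      unfolding G centers_family_prod[OF ns p F YX Yne] by (intro family_prod_nonempty P2'(1) F)
  next
    fix \<epsilon> :: real
    assume "0 < \<epsilon>"
    \<comment> \<open>The coordinate distances are added up through the l_1 bound, so each receives
      an equal share of \<epsilon>.\<close>
    define \<epsilon>' where "\<epsilon>' = \<epsilon> / CARD('i)"
    have "0 < \<epsilon>'"
      using \<open>0 < \<epsilon>\<close> by (simp add: \<epsilon>'_def)
    have "\<forall>i. \<exists>\<tau>>0. \<forall>F\<in>CB (X i) (N i). rad (N i) (Y i) F \<le> 1 \<longrightarrow>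
      (\<forall>y\<in>Y i. farthest (N i) y F \<le> rad (N i) (Y i) F + \<tau> \<longrightarrow> (\<exists>z\<in>centers (N i) (Y i) F. N i (y - z) \<le> \<epsilon>'))"
      using P2'(2)[OF \<open>0 < \<epsilon>'\<close>] by blast
    then obtain \<tau> where \<tau>: "\<And>i. 0 < \<tau> i" "\<And>i F y. \<lbrakk>F \<in> CB (X i) (N i); rad (N i) (Y i) F \<le> 1; y \<in> Y i;
        farthest (N i) y F \<le> rad (N i) (Y i) F + \<tau> i\<rbrakk> \<Longrightarrow> \<exists>z\<in>centers (N i) (Y i) F. N i (y - z) \<le> \<epsilon>'"
      by metis
    \<comment> \<open>Finiteness of the index set yields one positive tolerance for all
      coordinates.\<close>
    have "0 < Min (range \<tau>)"
      using \<tau>(1) by (subst Min_gr_iff) auto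
    then obtain \<delta> where "0 < \<delta>" and \<delta>: "\<And>(r :: 'i \<Rightarrow> real) s i. \<lbrakk>\<And>j. 0 \<le> r j; \<And>j. r j \<le> s j;
        lp_sum p r = 1; lp_sum p s \<le> 1 + \<delta>\<rbrakk> \<Longrightarrow> s i \<le> r i + Min (range \<tau>)"
      by (rule lp_sum_near_imp_component_near[OF p]) blast
    have "\<exists>z\<in>centers (lp_norm p N) (family_prod Y) G. lp_norm p N (y - z) \<le> \<epsilon>"
      if G: "G \<in> {F \<in> CB_prod p X N. rad (lp_norm p N) (family_prod Y) F = 1}"
        and y: "y \<in> near_centers (lp_norm p N) (family_prod Y) G \<delta>" for G y
    proof -
      obtain F where F: "\<And>i. F i \<in> CB (X i) (N i)" and GF: "G = family_prod F"
        using G by (auto simp: CB_prod_def)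
      have yY: "y $ i \<in> Y i" for i
        using y by (simp add: near_centers_def)
      have yX: "y \<in> family_prod X"
        using yY YX unfolding mem_family_prod by blast
      have one: "lp_sum p (\<lambda>i. rad (N i) (Y i) (F i)) = 1"
        using G by (simp add: GF rad_family_prod[OF ns p F YX Yne])
      have near: "lp_sum p (\<lambda>i. farthest (N i) (y $ i) (F i)) \<le> 1 + \<delta>"
        using y G by (simp add: near_centers_def GF farthest_family_prod[OF ns p F yX])
      have "\<exists>z\<in>centers (N i) (Y i) (F i). N i (y $ i - z) \<le> \<epsilon>'" for i
      proof (rule \<tau>(2)[OF F _ yY])
        show "rad (N i) (Y i) (F i) \<le> 1"
          using component_le_lp_sum[OF p, of "\<lambda>i. rad (N i) (Y i) (F i)" i] one rad_nonneg[OF ns F YX Yne]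
          by simp
        have "farthest (N i) (y $ i) (F i) \<le> rad (N i) (Y i) (F i) + Min (range \<tau>)"
          using rad_nonneg[OF ns F YX Yne] rad_le_farthest[OF ns F YX yY] one near by (rule \<delta>)
        also have "Min (range \<tau>) \<le> \<tau> i"
          by simp
        finally show "farthest (N i) (y $ i) (F i) \<le> rad (N i) (Y i) (F i) + \<tau> i"
          by simp
      qed
      then obtain z where z: "\<And>i. z i \<in> centers (N i) (Y i) (F i)" "\<And>i. N i (y $ i - z i) \<le> \<epsilon>'"
        by metis
      have "lp_norm p N (y - (\<chi> i. z i)) \<le> (\<Sum>i\<in>UNIV. N i (y $ i - z i))"
        using lp_sum_le_sum[OF p, of "\<lambda>i. N i (y $ i - z i)"] z(1) yY YX D(2,6)
        by (auto simp: lp_norm_eq_lp_sum centers_def subset_iff)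
      also have "\<dots> \<le> (\<Sum>i\<in>(UNIV :: 'i set). \<epsilon>')"
        by (intro sum_mono z(2))
      also have "\<dots> = \<epsilon>"
        by (simp add: \<epsilon>'_def)
      finally show ?thesis
        using z(1) unfolding GF centers_family_prod[OF ns p F YX Yne]
        by (intro bexI[of _ "\<chi> i. z i"]) auto
    qed
    then show "\<exists>\<delta>>0. \<forall>G\<in>{F \<in> CB_prod p X N. rad (lp_norm p N) (family_prod Y) F = 1}.
        \<forall>y\<in>near_centers (lp_norm p N) (family_prod Y) G \<delta>.
          \<exists>z\<in>centers (lp_norm p N) (family_prod Y) G. lp_norm p N (y - z) \<le> \<epsilon>"
      using \<open>0 < \<delta>\<close> by blast
  qed
qed

lemma property_P2_family_prodD:
  fixes X Y :: "'i::finite \<Rightarrow> 'a::real_vector set"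
  assumes ns: "\<And>i. normed_space (X i) (N i)" and Y: "\<And>i. subspace (Y i)" and YX: "\<And>i. Y i \<subseteq> X i"
    and p: "1 \<le> p"
    and P2: "property_P2 (family_prod X) (lp_norm p N) (family_prod Y)
      {F \<in> CB_prod p X N. rad (lp_norm p N) (family_prod Y) F = 1}"
  shows "property_P2 (X i) (N i) (Y i) {F \<in> CB (X i) (N i). rad (N i) (Y i) F = 1}"
proof -
  have Y0: "0 \<in> Y j" for j
    using Y subspace_0 by blast
  then have Yne: "Y j \<noteq> {}" for j
    by blast
  have YX': "family_prod Y \<subseteq> family_prod X"
    by (intro family_prod_mono YX)
  note D = normed_spaceD[OF ns]
    and P2 = P2[unfolded property_P2_iff[OF normed_space_family_prod[OF ns p] YX']]
  \<comment> \<open>The set {0} has radius 0 with center 0, so the padded box has the same radius as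
    G.\<close>
  define E where "E G j = (if j = i then G else {0})" for G :: "'a set" and j
  have E: "E G j \<in> CB (X j) (N j)" if "G \<in> CB (X i) (N i)" for G j
    using that singleton_0_in_CB[OF ns] by (simp add: E_def)
  have cen: "z $ i \<in> centers (N i) (Y i) G"
    if "G \<in> CB (X i) (N i)" "z \<in> centers (lp_norm p N) (family_prod Y) (family_prod (E G))" for z G
  proof -
    have "z $ i \<in> centers (N i) (Y i) (E G i)"
      using that by (simp add: centers_family_prod[OF ns p E YX Yne])
    then show ?thesis
      by (simp add: E_def)
  qed
  have rad: "rad (lp_norm p N) (family_prod Y) (family_prod (E G)) = rad (N i) (Y i) G"
    if "G \<in> CB (X i) (N i)" for G
  proof -
    have "(\<lambda>j. rad (N j) (Y j) (E G j)) = (\<lambda>j. if j = i then rad (N i) (Y i) G else 0)"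
      using rad_singleton_0[OF ns Y YX] by (auto simp: E_def)
    then show ?thesis
      using lp_sum_single[OF p] rad_nonneg[OF ns that YX Yne]
      by (simp add: rad_family_prod[OF ns p E[OF that] YX Yne])
  qed
  have mem: "family_prod (E G) \<in> {F \<in> CB_prod p X N. rad (lp_norm p N) (family_prod Y) F = 1}"
    if "G \<in> {F \<in> CB (X i) (N i). rad (N i) (Y i) F = 1}" for G
    using that E rad CB_family_prod[OF ns p E] by (auto simp: CB_prod_def)
  show ?thesis
    unfolding property_P2_iff[OF ns YX]
  proof (intro conjI ballI allI impI)
    show "centers (N i) (Y i) G \<noteq> {}" if "G \<in> {F \<in> CB (X i) (N i). rad (N i) (Y i) F = 1}" for G
      using P2 mem[OF that] cen that by blast
  next
    fix \<epsilon> :: real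
    assume "0 < \<epsilon>"
    then obtain \<delta> where "0 < \<delta>" and \<delta>: "\<And>G y. \<lbrakk>G \<in> {F \<in> CB_prod p X N. rad (lp_norm p N) (family_prod Y) F = 1};
        y \<in> near_centers (lp_norm p N) (family_prod Y) G \<delta>\<rbrakk>
        \<Longrightarrow> \<exists>z\<in>centers (lp_norm p N) (family_prod Y) G. lp_norm p N (y - z) \<le> \<epsilon>"
      using P2 by meson
    have "\<exists>z\<in>centers (N i) (Y i) G. N i (y - z) \<le> \<epsilon>"
      if G: "G \<in> {F \<in> CB (X i) (N i). rad (N i) (Y i) F = 1}"
        and y: "y \<in> near_centers (N i) (Y i) G \<delta>" for G y
    proof -
      have G': "G \<in> CB (X i) (N i)"
        using G by blast
      \<comment> \<open>Padding y with 0 adds no farthest distance in the other coordinates.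
        Farthest distance and radius are both preserved, so the \<delta> of the product serves the
        factor unchanged.\<close>
      define y' where "y' = (\<chi> j. if j = i then y else 0)"
      have y': "y' \<in> family_prod Y"
        using y Y0 by (simp add: y'_def near_centers_def)
      then have y'X: "y' \<in> family_prod X"
        using YX' by blast
      have "(\<lambda>j. farthest (N j) (y' $ j) (E G j)) = (\<lambda>j. if j = i then farthest (N i) y G else 0)"
        using D(9) by (auto simp: E_def y'_def farthest_def)
      then have "farthest (lp_norm p N) y' (family_prod (E G)) = farthest (N i) y G"
        using lp_sum_single[OF p] farthest_nonneg[OF ns G', of y] y YX
        by (auto simp: farthest_family_prod[OF ns p E[OF G'] y'X] near_centers_def subset_iff)
      then have "y' \<in> near_centers (lp_norm p N) (family_prod Y) (family_prod (E G)) \<delta>"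
        using y y' rad[OF G'] by (simp add: near_centers_def)
      then obtain z where z: "z \<in> centers (lp_norm p N) (family_prod Y) (family_prod (E G))"
          "lp_norm p N (y' - z) \<le> \<epsilon>"
        using \<delta>[OF mem[OF G]] by blast
      have "z \<in> family_prod X"
        using z(1) YX' unfolding centers_def by blast
      \<comment> \<open>Projection to a coordinate does not increase the norm, so the i-th
        coordinate of the center found in the product is close enough to y.\<close>
      then have "N i (y' $ i - z $ i) \<le> lp_norm p N (y' - z)"
        using component_le_lp_sum[OF p, of "\<lambda>j. N j ((y' - z) $ j)" i] y'X D(2,6)
        by (simp add: lp_norm_eq_lp_sum)
      then have "N i (y - z $ i) \<le> \<epsilon>"
        using z(2) by (simp add: y'_def)
      then show ?thesis
        using cen[OF G' z(1)] by blast
    qed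
    then show "\<exists>\<delta>>0. \<forall>G\<in>{F \<in> CB (X i) (N i). rad (N i) (Y i) F = 1}.
        \<forall>y\<in>near_centers (N i) (Y i) G \<delta>. \<exists>z\<in>centers (N i) (Y i) G. N i (y - z) \<le> \<epsilon>"
      using \<open>0 < \<delta>\<close> by blast
  qed
qed

theorem theorem3p7:
  fixes X Y :: "'i::finite \<Rightarrow> 'a::real_vector set"
    and N :: "'i \<Rightarrow> 'a \<Rightarrow> real"
    and p :: real
  assumes "\<And>i. banach_space (X i) (N i)"
    and "\<And>i. subspace (Y i)"
    and "\<And>i. closedin (Metric_space.mtopology (X i) (norm_dist (X i) (N i))) (Y i)"
    and "1 \<le> p"
  shows "(\<forall>i. property_P2 (X i) (N i) (Y i) {F \<in> CB (X i) (N i). rad (N i) (Y i) F = 1})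
    \<longleftrightarrow> property_P2 (family_prod X) (lp_norm p N) (family_prod Y)
          {F \<in> CB_prod p X N. rad (lp_norm p N) (family_prod Y) F = 1}"
proof -
  have ns: "normed_space (X i) (N i)" for i
    using assms(1) by (simp add: banach_space_def)
  have YX: "Y i \<subseteq> X i" for i
    using assms(3) by (simp add: closedin_normed_iff[OF ns])
  show ?thesis
  proof (intro iffI allI)
    assume *: "\<forall>i. property_P2 (X i) (N i) (Y i) {F \<in> CB (X i) (N i). rad (N i) (Y i) F = 1}"
    show "property_P2 (family_prod X) (lp_norm p N) (family_prod Y)
        {F \<in> CB_prod p X N. rad (lp_norm p N) (family_prod Y) F = 1}"
      by (intro property_P2_family_prodI ns assms spec[OF *])
  next
    fix i
    assume "property_P2 (family_prod X) (lp_norm p N) (family_prod Y)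
        {F \<in> CB_prod p X N. rad (lp_norm p N) (family_prod Y) F = 1}"
    then show "property_P2 (X i) (N i) (Y i) {F \<in> CB (X i) (N i). rad (N i) (Y i) F = 1}"
      by (intro property_P2_family_prodD[of X N Y p] ns assms YX)
  qed
qed

end
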